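(* Let $F=\bigcup_{i=1}^k S_{d_i}$ be a star forest with $k\geq 2$ and $d_1\geq\cdots\geq d_k\geq 1$, and let $0<\alpha<1$. If $G$ is an $F$-free graph of order $$n\geq \frac{4\left(\sum_{i=1}^k d_i+k-2\right)\left(\sum_{i=1}^k d_i+3k-5\right)}{\alpha^3},$$ then $\rho_\alpha(G)$ is no more than the largest root of $f_\alpha(x)=0$, where $$f_\alpha(x)=x^2-\big(\alpha n+k+d_k-3\big)x+\big(\alpha(n-k+1)+k-2\big)\big(\alpha(k-1)+d_k-1\big)-(1-\alpha)^2(k-1)(n-k+1),$$ and equality holds if and only if $G=K_{k-1}\nabla H$ (up to isomorphism) for some $(d_k-1)$-regular graph $H$ of order $n-k+1$.
   Context: All graphs are finite, simple and undirected; the order of a graph is its number of vertices. For a graph $G$ with adjacency matrix $A(G)$ and diagonal degree matrix $D(G)$, and a real number $0\le\alpha\le 1$, let $A_\alpha(G)=\alpha D(G)+(1-\alpha)A(G)$; the $\alpha$-index $\rho_\alpha(G)$ is the largest eigenvalue of $A_\alpha(G)$. $S_d$ denotes the star of order $d+1$ (one center joined to $d$ leaves). A star forest is a forest whose components are stars; $\bigcup_{i=1}^k S_{d_i}$ is the vertex-disjoint union of the stars. A graph is $F$-free if it does not contain $F$ as a (not necessarily induced) subgraph. $K_m$ is the complete graph on $m$ vertices and $G\nabla H$ is the join of vertex-disjoint graphs $G,H$, obtained by joining every vertex of $G$ to every vertex of $H$. *)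

theory Defs
  imports
    "Graph_Theory.Graph_Theory"
    "Jordan_Normal_Form.Char_Poly"
begin

text \<open>
  Finite simple undirected graphs are the \<^const>\<open>pair_graph\<close>s of Graph_Theory: finite, loop-free,
  and with a symmetric set of ordered pairs as arcs. Each undirected edge is thus represented by
  two opposite arcs, and the degree of a vertex is its \<^const>\<open>out_degree\<close>.
\<close>

abbreviation gdegree :: "'a pair_pre_digraph \<Rightarrow> 'a \<Rightarrow> nat" where
  "gdegree G v \<equiv> out_degree (with_proj G) v"

definition regular_graph :: "nat \<Rightarrow> 'a pair_pre_digraph \<Rightarrow> bool" where
  "regular_graph r G \<longleftrightarrow> (\<forall>v\<in>pverts G. gdegree G v = r)"

definition graph_isomorphic :: "'a pair_pre_digraph \<Rightarrow> 'b pair_pre_digraph \<Rightarrow> bool" where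
  "graph_isomorphic G H \<longleftrightarrow> digraph_iso (with_proj G) (with_proj H)"

definition contains_graph :: "'a pair_pre_digraph \<Rightarrow> 'b pair_pre_digraph \<Rightarrow> bool" where
  "contains_graph G F \<longleftrightarrow>
     (\<exists>S :: 'a pair_pre_digraph. subgraph (with_proj S) (with_proj G) \<and> graph_isomorphic F S)"

abbreviation graph_free :: "'b pair_pre_digraph \<Rightarrow> 'a pair_pre_digraph \<Rightarrow> bool" where
  "graph_free F G \<equiv> \<not> contains_graph G F"

definition star_graph :: "nat \<Rightarrow> nat pair_pre_digraph" where
  "star_graph d = \<lparr> pverts = {0..d}, parcs = {0} \<times> {1..d} \<union> {1..d} \<times> {0} \<rparr>"

definition disjoint_union :: "'i set \<Rightarrow> ('i \<Rightarrow> 'a pair_pre_digraph) \<Rightarrow> ('i \<times> 'a) pair_pre_digraph" where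
  "disjoint_union I G =
     \<lparr> pverts = (SIGMA i:I. pverts (G i)),
       parcs = {((i, u), (i, v)) | i u v. i \<in> I \<and> (u, v) \<in> parcs (G i)} \<rparr>"

definition star_forest :: "nat \<Rightarrow> (nat \<Rightarrow> nat) \<Rightarrow> (nat \<times> nat) pair_pre_digraph" where
  "star_forest k d = disjoint_union {1..k} (\<lambda>i. star_graph (d i))"

definition complete_graph :: "nat \<Rightarrow> nat pair_pre_digraph" where
  "complete_graph m = \<lparr> pverts = {..<m}, parcs = {(u, v). u < m \<and> v < m \<and> u \<noteq> v} \<rparr>"

definition graph_join ::
    "'a pair_pre_digraph \<Rightarrow> 'b pair_pre_digraph \<Rightarrow> ('a + 'b) pair_pre_digraph" (infixr \<open>\<nabla>\<close> 65) where
  "G \<nabla> H =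
     \<lparr> pverts = pverts G <+> pverts H,
       parcs = map_prod Inl Inl ` parcs G \<union> map_prod Inr Inr ` parcs H
         \<union> (Inl ` pverts G) \<times> (Inr ` pverts H) \<union> (Inr ` pverts H) \<times> (Inl ` pverts G) \<rparr>"

text \<open>
  The matrices of a graph are indexed by positions in a list \<open>vs\<close> enumerating its vertices.
\<close>

definition adjacency_mat :: "'a pair_pre_digraph \<Rightarrow> 'a list \<Rightarrow> real mat" where
  "adjacency_mat G vs =
     mat (length vs) (length vs) (\<lambda>(i, j). if (vs ! i, vs ! j) \<in> parcs G then 1 else 0)"

definition degree_mat :: "'a pair_pre_digraph \<Rightarrow> 'a list \<Rightarrow> real mat" where
  "degree_mat G vs =
     mat (length vs) (length vs) (\<lambda>(i, j). if i = j then real (gdegree G (vs ! i)) else 0)"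

definition A_alpha :: "real \<Rightarrow> 'a pair_pre_digraph \<Rightarrow> 'a list \<Rightarrow> real mat" where
  "A_alpha \<alpha> G vs = \<alpha> \<cdot>\<^sub>m degree_mat G vs + (1 - \<alpha>) \<cdot>\<^sub>m adjacency_mat G vs"

text \<open>
  The spectrum does not depend on the enumeration chosen below; see \<open>eigenvalue_A_alpha_iff\<close>.
\<close>

definition alpha_index :: "real \<Rightarrow> 'a pair_pre_digraph \<Rightarrow> real" where
  "alpha_index \<alpha> G =
     Max {x. eigenvalue (A_alpha \<alpha> G (SOME vs. distinct vs \<and> set vs = pverts G)) x}"

definition f_alpha :: "real \<Rightarrow> nat \<Rightarrow> nat \<Rightarrow> nat \<Rightarrow> real \<Rightarrow> real" where
  "f_alpha \<alpha> n k \<delta> x =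
     x\<^sup>2 - (\<alpha> * real n + real k + real \<delta> - 3) * x
     + (\<alpha> * (real n - real k + 1) + real k - 2) * (\<alpha> * (real k - 1) + real \<delta> - 1)
     - (1 - \<alpha>)\<^sup>2 * (real k - 1) * (real n - real k + 1)"

definition largest_root :: "(real \<Rightarrow> real) \<Rightarrow> real" where
  "largest_root f = Max {x. f x = 0}"

lemma A_alpha_mult_vec_index:
  assumes "distinct vs" "set vs = pverts G" "i < length vs"
  shows "(A_alpha \<alpha> G vs *\<^sub>v vec (length vs) (\<lambda>j. y (vs ! j))) $ i =
    \<alpha> * real (gdegree G (vs ! i)) * y (vs ! i)
     + (1 - \<alpha>) * (\<Sum>w\<in>pverts G. if (vs ! i, w) \<in> parcs G then y w else 0)"
proof -
  let ?n = "length vs"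
  have bij: "bij_betw (\<lambda>j. vs ! j) {0..<?n} (pverts G)"
    using bij_betw_nth[OF assms(1)] assms(2) by (simp add: lessThan_atLeast0)
  have "(A_alpha \<alpha> G vs *\<^sub>v vec ?n (\<lambda>j. y (vs ! j))) $ i =
    (\<Sum>j = 0..<?n. (if i = j then \<alpha> * real (gdegree G (vs ! i)) * y (vs ! i) else 0)
       + (1 - \<alpha>) * (if (vs ! i, vs ! j) \<in> parcs G then y (vs ! j) else 0))"
    using assms(3)
    by (auto simp: A_alpha_def degree_mat_def adjacency_mat_def scalar_prod_def algebra_simps
        intro!: sum.cong)
  also have "\<dots> = \<alpha> * real (gdegree G (vs ! i)) * y (vs ! i)
     + (1 - \<alpha>) * (\<Sum>j = 0..<?n. if (vs ! i, vs ! j) \<in> parcs G then y (vs ! j) else 0)"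
    using assms(3) by (simp add: sum.distrib flip: sum_distrib_left)
  also have "(\<Sum>j = 0..<?n. if (vs ! i, vs ! j) \<in> parcs G then y (vs ! j) else 0)
      = (\<Sum>w\<in>pverts G. if (vs ! i, w) \<in> parcs G then y w else 0)"
    by (rule sum.reindex_bij_betw[OF bij])
  finally show ?thesis .
qed

lemma eigenvalue_A_alpha_iff:
  assumes "distinct vs" "set vs = pverts G"
  shows "eigenvalue (A_alpha \<alpha> G vs) x \<longleftrightarrow>
    (\<exists>y. (\<exists>v\<in>pverts G. y v \<noteq> 0) \<and>
      (\<forall>v\<in>pverts G. \<alpha> * real (gdegree G v) * y v
         + (1 - \<alpha>) * (\<Sum>w\<in>pverts G. if (v, w) \<in> parcs G then y w else 0) = x * y v))"
    (is "?L \<longleftrightarrow> ?R")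
proof -
  let ?n = "length vs"
  have dim: "dim_row (A_alpha \<alpha> G vs) = ?n" by (simp add: A_alpha_def adjacency_mat_def)
  note index = A_alpha_mult_vec_index[OF assms]
  have inj: "inj_on ((!) vs) {..<?n}" using assms(1) by (simp add: inj_on_nth)
  show ?thesis
  proof
    assume ?L
    then obtain z where z: "z \<in> carrier_vec ?n" "z \<noteq> 0\<^sub>v ?n" "A_alpha \<alpha> G vs *\<^sub>v z = x \<cdot>\<^sub>v z"
      by (auto simp: eigenvalue_def eigenvector_def dim)
    define y where "y v = z $ (the_inv_into {..<?n} ((!) vs) v)" for v
    have y: "y (vs ! i) = z $ i" if "i < ?n" for i
      using that the_inv_into_f_f[OF inj, of i] by (simp add: y_def)
    have zy: "z = vec ?n (\<lambda>j. y (vs ! j))" using z(1) y by auto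
    obtain i where i: "i < ?n" "z $ i \<noteq> 0" using z(1,2) by (metis carrier_vecD eq_vecI index_zero_vec)
    have "\<exists>v\<in>pverts G. y v \<noteq> 0" using i y assms(2) by (metis nth_mem)
    moreover have "\<alpha> * real (gdegree G v) * y v
         + (1 - \<alpha>) * (\<Sum>w\<in>pverts G. if (v, w) \<in> parcs G then y w else 0) = x * y v"
      if v: "v \<in> pverts G" for v
    proof -
      obtain j where j: "j < ?n" "v = vs ! j" using v assms(2) by (metis in_set_conv_nth)
      have "(A_alpha \<alpha> G vs *\<^sub>v z) $ j = x * y v" using z j y by simp
      then show ?thesis using index[OF j(1), of \<alpha> y] j(2) zy by simp
    qed
    ultimately show ?R by blast
  next
    assume ?R
    then obtain y where y: "\<exists>v\<in>pverts G. y v \<noteq> 0"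
      "\<And>v. v \<in> pverts G \<Longrightarrow> \<alpha> * real (gdegree G v) * y v
         + (1 - \<alpha>) * (\<Sum>w\<in>pverts G. if (v, w) \<in> parcs G then y w else 0) = x * y v" by blast
    let ?z = "vec ?n (\<lambda>j. y (vs ! j))"
    obtain i where i: "i < ?n" "y (vs ! i) \<noteq> 0" using y(1) assms(2) by (metis in_set_conv_nth)
    have "?z \<noteq> 0\<^sub>v ?n" using i by (metis index_vec index_zero_vec(1))
    moreover have "A_alpha \<alpha> G vs *\<^sub>v ?z = x \<cdot>\<^sub>v ?z"
    proof (rule eq_vecI)
      fix j assume "j < dim_vec (x \<cdot>\<^sub>v ?z)"
      then have j: "j < ?n" by simp
      then have "vs ! j \<in> pverts G" using assms(2) nth_mem by blast
      then show "(A_alpha \<alpha> G vs *\<^sub>v ?z) $ j = (x \<cdot>\<^sub>v ?z) $ j"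
        unfolding index[OF j, of \<alpha> y] using y(2) j by simp
    qed (simp add: dim)
    ultimately show ?L unfolding eigenvalue_def eigenvector_def dim using vec_carrier by blast
  qed
qed

end

theory Submission
  imports Defs "Jordan_Normal_Form.Spectral_Radius" "HOL-Library.Disjoint_Sets"
begin

text \<open>
  Let \<open>K = k - 1\<close>, \<open>s = \<Sum>d\<^sub>i\<close>, and let \<open>L\<close> be the set of vertices of degree at least \<open>s + k - 1\<close>.
  Stars with centres in \<open>L\<close> can be placed greedily around any star that is already embedded, so
  \<open>F\<close>-freeness forces \<open>card L \<le> K\<close>, and if \<open>card L = K\<close> then \<open>G - L\<close> has maximum degree at most
  \<open>d\<^sub>k - 1\<close>. The largest root \<open>\<theta>\<close> of \<open>f\<^sub>\<alpha>\<close> is the top eigenvalue of the quotient matrix of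
  \<open>K\<^sub>K \<nabla> H\<close>; take its positive eigenvector and transplant it to \<open>G\<close> as the vector \<open>y\<close> with value
  \<open>1\<close> on \<open>L\<close> and \<open>b\<close> elsewhere. If \<open>card L = K\<close> then \<open>A\<^sub>\<alpha> y \<le> \<theta> y\<close>, with equality everywhere only
  for the extremal graphs. If \<open>card L < K\<close>, the same \<open>y\<close> satisfies \<open>A\<^sub>\<alpha> y < \<theta> y\<close>: the degrees outside
  \<open>L\<close> may now be as large as \<open>s + k - 2\<close>, but \<open>b\<close> is small since \<open>\<theta>\<close> is of order \<open>\<alpha> n\<close>. No connectivity
  is needed, because tight vertices where an eigenvector is maximal relative to \<open>y\<close> propagate
  along edges and through \<open>L\<close>.
\<close>

section \<open>Isomorphism and containment of simple graphs\<close>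

abbreviation nbrs :: "'a pair_pre_digraph \<Rightarrow> 'a \<Rightarrow> 'a set" where
  "nbrs G v \<equiv> parcs G `` {v}"

lemma gdegree_eq_card_nbrs: "gdegree G v = card (nbrs G v)"
proof -
  have "out_arcs (with_proj G) v = Pair v ` nbrs G v"
    by (auto simp: out_arcs_def)
  then show ?thesis
    by (simp add: out_degree_def card_image inj_on_def)
qed

lemma nbrs_subset: "pair_wf_digraph G \<Longrightarrow> nbrs G v \<subseteq> pverts G"
  by (auto dest: pair_wf_digraph.in_arcsD2)

lemma (in pair_graph) nbrs_sym: "w \<in> nbrs G v \<longleftrightarrow> v \<in> nbrs G w"
  using pair_sym_arcs by (auto simp: symmetric_def sym_def)

lemma (in pair_graph) self_notin_nbrs: "v \<notin> nbrs G v"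
  using pair_no_loops by force

lemma map_prod_image_iff:
  assumes "inj_on h A" "R \<subseteq> A \<times> A" "u \<in> A" "v \<in> A"
  shows "(h u, h v) \<in> map_prod h h ` R \<longleftrightarrow> (u, v) \<in> R"
proof
  assume "(h u, h v) \<in> map_prod h h ` R"
  then obtain u' v' where R: "(u', v') \<in> R" and h: "h u = h u'" "h v = h v'" by auto
  have "u' \<in> A" "v' \<in> A" using R assms(2) by auto
  then have "u = u'" "v = v'" using inj_onD[OF assms(1)] h assms(3,4) by blast+
  then show "(u, v) \<in> R" using R by simp
qed auto

lemma (in pair_wf_digraph) arcs_subset_verts: "parcs G \<subseteq> pverts G \<times> pverts G"
  by (auto dest: in_arcsD1 in_arcsD2)

text \<open>An arc of a pair digraph is the pair of its ends, so the vertex map of an isomorphism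
  forces its arc map to be \<open>map_prod h h\<close>. Isomorphisms can therefore be handled as
  vertex bijections that preserve and reflect arcs.\<close>

lemma graph_isomorphic_iff:
  assumes "pair_wf_digraph G" "pair_wf_digraph H"
  shows "graph_isomorphic G H \<longleftrightarrow>
    (\<exists>h. bij_betw h (pverts G) (pverts H) \<and>
      (\<forall>u\<in>pverts G. \<forall>v\<in>pverts G. (u, v) \<in> parcs G \<longleftrightarrow> (h u, h v) \<in> parcs H))"
    (is "?L \<longleftrightarrow> ?R")
proof
  assume ?L
  then obtain f where f: "pre_digraph.digraph_isomorphism (with_proj G) f"
    and H: "with_proj H = app_iso f (with_proj G)"
    by (auto simp: graph_isomorphic_def digraph_iso_def)
  define h where "h = iso_verts f"
  have verts: "pverts H = h ` pverts G" and arcs: "parcs H = iso_arcs f ` parcs G"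
    and ends: "iso_tail f = fst" "iso_head f = snd"
    using arg_cong[OF H, of verts] arg_cong[OF H, of arcs]
      arg_cong[OF H, of tail] arg_cong[OF H, of head] by (simp_all add: h_def)
  have inj: "inj_on h (pverts G)"
    using pre_digraph.digraph_isomorphism_inj_on_verts[OF f] by (simp add: h_def)
  have "iso_arcs f a = map_prod h h a" if "a \<in> parcs G" for a
    using f that unfolding pre_digraph.digraph_isomorphism_def
    by (auto simp: ends h_def prod_eq_iff)
  then have arcs': "parcs H = map_prod h h ` parcs G"
    using arcs by (metis image_cong)
  have "(u, v) \<in> parcs G \<longleftrightarrow> (h u, h v) \<in> parcs H" if "u \<in> pverts G" "v \<in> pverts G" for u v
    using map_prod_image_iff[OF inj pair_wf_digraph.arcs_subset_verts[OF assms(1)] that] arcs' by simp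
  then show ?R using inj verts by (auto simp: bij_betw_def)
next
  assume ?R
  then obtain h where bij: "bij_betw h (pverts G) (pverts H)"
    and h: "\<And>u v. u \<in> pverts G \<Longrightarrow> v \<in> pverts G \<Longrightarrow> (u, v) \<in> parcs G \<longleftrightarrow> (h u, h v) \<in> parcs H"
    by blast
  define f where "f = \<lparr>iso_verts = h, iso_arcs = map_prod h h, iso_head = snd, iso_tail = fst\<rparr>"
  note wfG = pair_wf_digraph.wellformed'[OF assms(1)]
  have inj: "inj_on h (pverts G)" using bij by (simp add: bij_betw_def)
  have "inj_on (map_prod h h) (parcs G)"
    using inj wfG by (auto simp: inj_on_def)
  then have iso: "pre_digraph.digraph_isomorphism (with_proj G) f"
    using assms(1) inj by (auto simp: pre_digraph.digraph_isomorphism_def f_def wf_digraph_wp_iff)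
  have "parcs H \<subseteq> map_prod h h ` parcs G"
  proof
    fix a assume a: "a \<in> parcs H"
    obtain x y where xy: "a = (x, y)" by force
    have "x \<in> h ` pverts G" "y \<in> h ` pverts G"
      using a pair_wf_digraph.wellformed'[OF assms(2)] bij_betw_imp_surj_on[OF bij] unfolding xy by blast+
    then obtain u v where "u \<in> pverts G" "v \<in> pverts G" "x = h u" "y = h v" by blast
    then have "(u, v) \<in> parcs G" "a = map_prod h h (u, v)" using h a xy by simp_all
    then show "a \<in> map_prod h h ` parcs G" by blast
  qed
  moreover have "map_prod h h ` parcs G \<subseteq> parcs H"
  proof
    fix a assume "a \<in> map_prod h h ` parcs G"
    then obtain u v where uv: "(u, v) \<in> parcs G" "a = (h u, h v)" by auto
    then show "a \<in> parcs H" using h[OF wfG[OF uv(1)]] by simp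
  qed
  ultimately have "parcs H = map_prod h h ` parcs G" by (rule equalityI)
  then have "with_proj H = app_iso f (with_proj G)"
    using bij_betw_imp_surj_on[OF bij]
    by (intro pre_digraph.equality) (simp_all add: f_def)
  then show ?L using iso by (auto simp: graph_isomorphic_def digraph_iso_def)
qed

text \<open>The subgraph is the image of \<open>F\<close> under \<open>h\<close>. Further arcs of
  \<open>G\<close> between image vertices are simply left out, so \<open>h\<close> has to preserve
  arcs but not to reflect them.\<close>

lemma contains_graphI:
  fixes F :: "'b pair_pre_digraph" and G :: "'a pair_pre_digraph"
  assumes F: "pair_wf_digraph F" and G: "pair_wf_digraph G"
    and inj: "inj_on h (pverts F)" and verts: "h ` pverts F \<subseteq> pverts G"
    and arcs: "\<And>u v. (u, v) \<in> parcs F \<Longrightarrow> (h u, h v) \<in> parcs G"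
  shows "contains_graph G F"
proof -
  define S where "S = \<lparr>pverts = h ` pverts F, parcs = map_prod h h ` parcs F\<rparr>"
  have S: "pair_wf_digraph S"
    using pair_wf_digraph.wellformed'[OF F] by unfold_locales (auto simp: S_def)
  have "subgraph (with_proj S) (with_proj G)"
    using F G S verts arcs
    by (auto simp: subgraph_def wf_digraph_wp_iff S_def compatible_def)
  moreover have "graph_isomorphic F S"
    unfolding graph_isomorphic_iff[OF F S]
  proof (intro exI conjI ballI)
    show "bij_betw h (pverts F) (pverts S)" using inj by (simp add: bij_betw_def S_def)
    fix u v assume "u \<in> pverts F" "v \<in> pverts F"
    then show "(u, v) \<in> parcs F \<longleftrightarrow> (h u, h v) \<in> parcs S"
      by (simp add: S_def map_prod_image_iff[OF inj pair_wf_digraph.arcs_subset_verts[OF F]])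
  qed
  ultimately show ?thesis by (auto simp: contains_graph_def)
qed

section \<open>Embedding star forests\<close>

lemma pair_wf_star_forest: "pair_wf_digraph (star_forest k d)"
  by unfold_locales (auto simp: star_forest_def disjoint_union_def star_graph_def)

text \<open>Embedding the forest amounts to choosing distinct centres \<open>c i\<close> and
  pairwise disjoint leaf sets \<open>S i\<close> that avoid all centres.\<close>

lemma contains_star_forestI:
  assumes G: "pair_graph G" and c: "inj_on c {1..k}" "c ` {1..k} \<subseteq> pverts G"
    and S: "\<And>i. i \<in> {1..k} \<Longrightarrow> S i \<subseteq> nbrs G (c i) - c ` {1..k}"
    and card: "\<And>i. i \<in> {1..k} \<Longrightarrow> card (S i) = d i"
    and disj: "disjoint_family_on S {1..k}"
  shows "contains_graph G (star_forest k d)"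
proof -
  interpret pair_graph G by fact
  have wf: "pair_wf_digraph G" ..
  have SV: "S i \<subseteq> pverts G" if "i \<in> {1..k}" for i
    using S[OF that] nbrs_subset[OF wf] by blast
  have "\<exists>g. bij_betw g {1..d i} (S i)" if "i \<in> {1..k}" for i
    using card[OF that] SV[OF that] finite_subset[OF _ pair_finite_verts]
    by (intro finite_same_card_bij) auto
  then obtain g where g: "\<And>i. i \<in> {1..k} \<Longrightarrow> bij_betw (g i) {1..d i} (S i)" by metis
  \<comment> \<open>Vertex 0 of each \<open>star_graph\<close> is its centre; the leaves
    \<open>1, ..., d i\<close> are numbered off along \<open>S i\<close> by
    \<open>g i\<close>.\<close>
  define h where "h = (\<lambda>(i, u). if u = 0 then c i else g i u)"
  have gS: "g i u \<in> S i" if "i \<in> {1..k}" "u \<in> {1..d i}" for i u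
    using bij_betwE[OF g] that by blast
  have verts: "pverts (star_forest k d) = (SIGMA i:{1..k}. {0..d i})"
    by (auto simp: star_forest_def disjoint_union_def star_graph_def)
  show ?thesis
  proof (rule contains_graphI[OF pair_wf_star_forest wf, of h])
    show "inj_on h (pverts (star_forest k d))"
    proof (rule inj_onI)
      fix p q assume "p \<in> pverts (star_forest k d)" "q \<in> pverts (star_forest k d)" "h p = h q"
      moreover obtain i u j v where pq: "p = (i, u)" "q = (j, v)" by force
      ultimately have ij: "i \<in> {1..k}" "j \<in> {1..k}" "u \<le> d i" "v \<le> d j" and eq: "h (i, u) = h (j, v)"
        by (auto simp: verts)
      have cS: "c a \<noteq> g b w" if "a \<in> {1..k}" "b \<in> {1..k}" "w \<in> {1..d b}" for a b w
        using S[of b] gS[of b w] that by force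
      show "p = q"
      proof (cases "u = 0 \<or> v = 0")
        case True
        then have "u = 0" "v = 0" "c i = c j"
          using eq cS[of i j v] cS[of j i u] ij by (auto simp: h_def split: if_splits)
        then show ?thesis using c(1) ij pq by (auto dest: inj_onD)
      next
        case False
        then have uv: "u \<in> {1..d i}" "v \<in> {1..d j}" "g i u = g j v"
          using eq ij by (auto simp: h_def)
        then have "i = j"
          using gS[of i u] gS[of j v] disj ij unfolding disjoint_family_on_def by (metis disjoint_iff)
        then show ?thesis
          using g[OF ij(1)] uv pq by (auto simp: bij_betw_def dest: inj_onD)
      qed
    qed
    show "h ` pverts (star_forest k d) \<subseteq> pverts G"
    proof
      fix w assume "w \<in> h ` pverts (star_forest k d)"
      then obtain i u where iu: "i \<in> {1..k}" "u \<le> d i" "w = h (i, u)" by (auto simp: verts)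
      show "w \<in> pverts G"
        using iu c(2) gS[of i u] SV[of i] by (cases "u = 0") (auto simp: h_def)
    qed
    fix p q assume "(p, q) \<in> parcs (star_forest k d)"
    then obtain i u v where pq: "p = (i, u)" "q = (i, v)" "i \<in> {1..k}"
      and uv: "u = 0 \<and> v \<in> {1..d i} \<or> v = 0 \<and> u \<in> {1..d i}"
      by (auto simp: star_forest_def disjoint_union_def star_graph_def)
    have "g i u \<in> nbrs G (c i)" if "u \<in> {1..d i}" for u
      using S[OF pq(3)] gS[OF pq(3) that] by blast
    then show "(h p, h q) \<in> parcs G"
      using uv nbrs_sym pq by (auto simp: h_def)
  qed
qed

text \<open>A greedy choice, one index at a time: the sets chosen earlier cover at most
  \<open>sum d I\<close> elements, so \<open>N j\<close> still has \<open>d j\<close> elements left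
  for the new index.\<close>

lemma disjoint_subsets_of_card:
  assumes "finite I" "\<And>i. i \<in> I \<Longrightarrow> finite (N i)" "\<And>i. i \<in> I \<Longrightarrow> sum d I \<le> card (N i)"
  shows "\<exists>S. (\<forall>i\<in>I. S i \<subseteq> N i \<and> card (S i) = d i) \<and> disjoint_family_on S I"
  using assms
proof (induction I)
  case empty
  then show ?case by (auto simp: disjoint_family_on_def)
next
  case (insert j I)
  have "sum d I \<le> card (N i)" if "i \<in> I" for i
    using insert.prems(2)[of i] insert.hyps that by simp
  then obtain S where S: "\<And>i. i \<in> I \<Longrightarrow> S i \<subseteq> N i \<and> card (S i) = d i" "disjoint_family_on S I"
    using insert by (metis insertI2)
  define U where "U = (\<Union>i\<in>I. S i)"
  have finS: "finite (S i)" if "i \<in> I" for i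
    using S(1)[OF that] insert.prems(1) that finite_subset by blast
  have "card U \<le> (\<Sum>i\<in>I. card (S i))" unfolding U_def by (rule card_UN_le[OF insert.hyps(1)])
  also have "\<dots> = sum d I" using S(1) by simp
  finally have "card U \<le> sum d I" .
  moreover have "finite U" using finS insert.hyps by (auto simp: U_def)
  then have "card (N j) - card U \<le> card (N j - U)" by (rule diff_card_le_card_Diff)
  ultimately have "d j \<le> card (N j - U)"
    using insert.prems(2)[of j] insert.hyps by simp
  then obtain T where T: "T \<subseteq> N j - U" "card T = d j" by (meson obtain_subset_with_card_n)
  have "disjoint_family_on (S(j := T)) (insert j I)"
    using S(2) T(1) insert.hyps(2) by (force simp: disjoint_family_on_def U_def)
  moreover have "\<forall>i\<in>insert j I. (S(j := T)) i \<subseteq> N i \<and> card ((S(j := T)) i) = d i"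
    using S(1) T insert.hyps(2) by auto
  ultimately show ?case by blast
qed

text \<open>The smallest star is placed first, at \<open>v\<close> with leaves outside
  \<open>L\<close>. This star and the centres in \<open>L\<close> occupy at most
  \<open>k + d k\<close> vertices, and the degrees in \<open>L\<close> are large enough for the
  other \<open>k - 1\<close> stars to find their leaves greedily among the remaining
  vertices.\<close>

lemma contains_star_forest_of_large_degrees:
  assumes G: "pair_graph G" and k: "k \<ge> 1"
    and L: "L \<subseteq> pverts G" "card L = k - 1"
    and deg: "\<And>u. u \<in> L \<Longrightarrow> (\<Sum>i=1..k. d i) + k - 1 \<le> card (nbrs G u)"
    and v: "v \<in> pverts G - L" "d k \<le> card (nbrs G v - L)"
  shows "contains_graph G (star_forest k d)"
proof -
  interpret pair_graph G by fact
  have wf: "pair_wf_digraph G" ..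
  have finL: "finite L" using L(1) pair_finite_verts finite_subset by blast
  have finN: "finite (nbrs G u)" for u
    using nbrs_subset[OF wf] pair_finite_verts finite_subset by blast
  have Ik: "{1..k} = insert k {1..k-1}" using k by auto
  obtain c where c: "bij_betw c {1..k-1} L"
    using finite_same_card_bij[of "{1..k-1}" L] finL L(2) by auto
  define c' where "c' = c(k := v)"
  have c': "c' ` {1..k-1} = L" "c' ` {1..k} = insert v L" "inj_on c' {1..k}"
  proof -
    have 1: "c' i = c i" if "i \<in> {1..k-1}" for i using that k by (auto simp: c'_def)
    show 2: "c' ` {1..k-1} = L"
      using image_cong[of "{1..k-1}" _ c' c] 1 bij_betw_imp_surj_on[OF c] by simp
    have "c' ` {1..k} = insert (c' k) (c' ` {1..k-1})" by (subst Ik) (rule image_insert)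
    then show "c' ` {1..k} = insert v L" unfolding 2 by (simp add: c'_def)
    have "inj_on c' {1..k-1}"
      using inj_on_cong[of "{1..k-1}" c' c] 1 bij_betw_imp_inj_on[OF c] by blast
    moreover have "c' k \<notin> c' ` {1..k-1}" unfolding 2 using v(1) by (simp add: c'_def)
    ultimately show "inj_on c' {1..k}" by (subst Ik) (auto simp: inj_on_insert)
  qed
  obtain T where T: "T \<subseteq> nbrs G v - L" "card T = d k" by (meson v(2) obtain_subset_with_card_n)
  have finT: "finite T" using T finN finite_subset by blast
  \<comment> \<open>\<open>X\<close> holds every vertex that the leaves of the other stars must
    avoid: all centres and the leaves at \<open>v\<close>.\<close>
  define X where "X = insert v L \<union> T"
  have "card X \<le> card (insert v L) + card T" unfolding X_def by (rule card_Un_le)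
  then have cX: "card X \<le> k + d k" using finL L(2) k v(1) T(2) by simp
  have sum: "(\<Sum>i=1..k. d i) = d k + (\<Sum>i=1..k-1. d i)"
    by (subst Ik, subst sum.insert) (use k in auto)
  have bound: "(\<Sum>i=1..k-1. d i) \<le> card (nbrs G (c' i) - X)" if "i \<in> {1..k-1}" for i
  proof -
    have u: "c' i \<in> L" using that c'(1) by blast
    \<comment> \<open>The centre \<open>c' i\<close> lies in \<open>X\<close> but is not its own
      neighbour, so at most \<open>k + d k - 1\<close> of its neighbours are lost. This saving of
      one is why the degree threshold \<open>s + k - 1\<close>, with \<open>s\<close> the sum of all
      \<open>d i\<close>, suffices.\<close>
    have "c' i \<in> X" using u by (simp add: X_def)
    then have "card (X - {c' i}) \<le> k + d k - 1" using cX by simp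
    moreover have "card (nbrs G (c' i)) - card (X - {c' i}) \<le> card (nbrs G (c' i) - (X - {c' i}))"
      using finL finT by (intro diff_card_le_card_Diff) (simp add: X_def)
    moreover have "nbrs G (c' i) - (X - {c' i}) = nbrs G (c' i) - X"
      using self_notin_nbrs[of "c' i"] by blast
    then have "card (nbrs G (c' i) - (X - {c' i})) = card (nbrs G (c' i) - X)" by (rule arg_cong)
    ultimately show ?thesis using deg[OF u] sum k by linarith
  qed
  obtain S where S: "\<And>i. i \<in> {1..k-1} \<Longrightarrow> S i \<subseteq> nbrs G (c' i) - X \<and> card (S i) = d i"
    "disjoint_family_on S {1..k-1}"
  proof -
    have "\<exists>S. (\<forall>i\<in>{1..k-1}. S i \<subseteq> nbrs G (c' i) - X \<and> card (S i) = d i) \<and> disjoint_family_on S {1..k-1}"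
      by (rule disjoint_subsets_of_card) (simp_all only: finite_atLeastAtMost finite_Diff[OF finN] bound)
    then show thesis using that by blast
  qed
  define S' where "S' = S(k := T)"
  have S': "S' i = S i" if "i \<in> {1..k-1}" for i using that k by (auto simp: S'_def)
  have I: "i \<in> {1..k-1}" if "i \<in> {1..k}" "i \<noteq> k" for i using that by auto
  show ?thesis
  proof (rule contains_star_forestI[OF G c'(3), where S = S'])
    show "c' ` {1..k} \<subseteq> pverts G" unfolding c'(2) using L v by blast
    show "S' i \<subseteq> nbrs G (c' i) - c' ` {1..k}" if "i \<in> {1..k}" for i
    proof (cases "i = k")
      case True
      then have "S' i = T" "c' i = v" by (simp_all add: S'_def c'_def)
      then show ?thesis using T(1) self_notin_nbrs[of v] unfolding c'(2) by auto
    next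
      case False
      then have "i \<in> {1..k-1}" using I[OF that] by simp
      then have "S' i \<subseteq> nbrs G (c' i) - X" using S(1) S' by simp
      then show ?thesis unfolding c'(2) X_def by blast
    qed
    show "card (S' i) = d i" if "i \<in> {1..k}" for i
    proof (cases "i = k")
      case False
      then show ?thesis using S(1)[OF I[OF that]] S'[OF I[OF that]] by simp
    qed (simp add: S'_def T(2))
    show "disjoint_family_on S' {1..k}"
      unfolding disjoint_family_on_def
    proof (intro ballI impI)
      fix i j assume ij: "i \<in> {1..k}" "j \<in> {1..k}" "i \<noteq> j"
      have 1: "S' a \<inter> T = {}" if "a \<in> {1..k}" "a \<noteq> k" for a
        using S(1)[OF I[OF that]] S'[OF I[OF that]] by (auto simp: X_def)
      have T': "S' k = T" by (simp add: S'_def)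
      show "S' i \<inter> S' j = {}"
      proof (cases "i = k \<or> j = k")
        case True
        then show ?thesis using 1[of i] 1[of j] ij by (auto simp: T')
      next
        case False
        then have "i \<in> {1..k-1}" "j \<in> {1..k-1}" using I ij by auto
        then show ?thesis using S(2) ij(3) S' unfolding disjoint_family_on_def by simp
      qed
    qed
  qed
qed

section \<open>Eigenvalues and positive test vectors\<close>

text \<open>Ensures that the maximum in \<open>alpha_index\<close> is over a nonempty set. Split a
  complex eigenvector for \<open>e\<close> into real and imaginary parts \<open>u\<close> and
  \<open>w\<close>. Symmetry gives \<open>w \<bullet> A u = A w \<bullet> u\<close>, that is
  \<open>Im e * (u \<bullet> u + w \<bullet> w) = 0\<close>, so \<open>e\<close> is real and
  whichever of \<open>u\<close>, \<open>w\<close> is nonzero is a real eigenvector.\<close>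

lemma symmetric_real_mat_has_eigenvalue:
  fixes A :: "real mat"
  assumes A: "A \<in> carrier_mat n n" and n: "n > 0" and sym: "A\<^sup>T = A"
  shows "\<exists>x. eigenvalue A x"
proof -
  define B where "B = map_mat complex_of_real A"
  have B: "B \<in> carrier_mat n n" using A by (simp add: B_def)
  obtain e where "eigenvalue B e" using spectrum_non_empty[OF B n] by (auto simp: spectrum_def)
  then obtain z where z: "z \<in> carrier_vec n" "z \<noteq> 0\<^sub>v n" "B *\<^sub>v z = e \<cdot>\<^sub>v z"
    using B by (auto simp: eigenvalue_def eigenvector_def)
  define u where "u = map_vec Re z"
  define w where "w = map_vec Im z"
  have uw: "u \<in> carrier_vec n" "w \<in> carrier_vec n" using z(1) by (simp_all add: u_def w_def)
  have Au: "A *\<^sub>v u = Re e \<cdot>\<^sub>v u - Im e \<cdot>\<^sub>v w" and Aw: "A *\<^sub>v w = Im e \<cdot>\<^sub>v u + Re e \<cdot>\<^sub>v w"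
  proof -
    have row: "(\<Sum>j = 0..<n. complex_of_real (A $$ (i, j)) * z $ j) = e * z $ i" if "i < n" for i
      using arg_cong[OF z(3), of "\<lambda>v. v $ i"] that A z(1) by (simp add: B_def scalar_prod_def)
    show "A *\<^sub>v u = Re e \<cdot>\<^sub>v u - Im e \<cdot>\<^sub>v w"
    proof (rule eq_vecI)
      fix i assume "i < dim_vec (Re e \<cdot>\<^sub>v u - Im e \<cdot>\<^sub>v w)"
      then have i: "i < n" using uw by simp
      show "(A *\<^sub>v u) $ i = (Re e \<cdot>\<^sub>v u - Im e \<cdot>\<^sub>v w) $ i"
        using arg_cong[OF row[OF i], of Re] i A z(1) uw
        by (simp add: u_def w_def scalar_prod_def)
    qed (use A uw in auto)
    show "A *\<^sub>v w = Im e \<cdot>\<^sub>v u + Re e \<cdot>\<^sub>v w"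
    proof (rule eq_vecI)
      fix i assume "i < dim_vec (Im e \<cdot>\<^sub>v u + Re e \<cdot>\<^sub>v w)"
      then have i: "i < n" using uw by simp
      show "(A *\<^sub>v w) $ i = (Im e \<cdot>\<^sub>v u + Re e \<cdot>\<^sub>v w) $ i"
        using arg_cong[OF row[OF i], of Im] i A z(1) uw
        by (simp add: u_def w_def scalar_prod_def)
    qed (use A uw in auto)
  qed
  have "w \<bullet> (A *\<^sub>v u) = (A *\<^sub>v w) \<bullet> u"
    using A uw sym by (metis assoc_scalar_prod mult_mat_vec_carrier transpose_vec_mult_scalar comm_scalar_prod)
  moreover have "w \<bullet> u = u \<bullet> w" by (rule comm_scalar_prod[OF uw(2,1)])
  ultimately have "Im e * (u \<bullet> u + w \<bullet> w) = 0"
    using uw by (simp add: Au Aw scalar_prod_minus_distrib[where n=n] add_scalar_prod_distrib[where n=n] algebra_simps)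
  moreover have "u \<noteq> 0\<^sub>v n \<or> w \<noteq> 0\<^sub>v n"
  proof (rule ccontr)
    assume 0: "\<not> (u \<noteq> 0\<^sub>v n \<or> w \<noteq> 0\<^sub>v n)"
    then have "Re (z $ i) = 0" "Im (z $ i) = 0" if "i < n" for i
    proof -
      have "u $ i = Re (z $ i)" "w $ i = Im (z $ i)" using that z(1) by (auto simp: u_def w_def)
      then show "Re (z $ i) = 0" "Im (z $ i) = 0" using that 0 by auto
    qed
    then have "z = 0\<^sub>v n" using z(1) by (intro eq_vecI) (auto simp: complex_eq_iff)
    then show False using z(2) by blast
  qed
  then have "u \<bullet> u + w \<bullet> w \<noteq> 0"
  proof -
    have "v \<bullet> v \<ge> 0" "v \<noteq> 0\<^sub>v n \<Longrightarrow> v \<bullet> v \<noteq> 0" if "v \<in> carrier_vec n" for v :: "real vec"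
      using that by (auto simp: scalar_prod_def sum_nonneg sum_nonneg_eq_0_iff intro!: eq_vecI)
    then show ?thesis
      using uw \<open>u \<noteq> 0\<^sub>v n \<or> w \<noteq> 0\<^sub>v n\<close> by (metis add_nonneg_eq_0_iff)
  qed
  ultimately have "Im e = 0" by simp
  then have "A *\<^sub>v u = Re e \<cdot>\<^sub>v u" "A *\<^sub>v w = Re e \<cdot>\<^sub>v w"
    using Au Aw uw by auto
  then have "eigenvalue A (Re e)"
    using A uw \<open>u \<noteq> 0\<^sub>v n \<or> w \<noteq> 0\<^sub>v n\<close> unfolding eigenvalue_def eigenvector_def by auto
  then show ?thesis ..
qed

text \<open>The entry at \<open>v\<close> of the product of the matrix \<open>A_alpha\<close> with
  \<open>y\<close>, written over vertices so that no enumeration of them is involved.\<close>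

definition A_alpha_apply :: "real \<Rightarrow> 'a pair_pre_digraph \<Rightarrow> ('a \<Rightarrow> real) \<Rightarrow> 'a \<Rightarrow> real" where
  "A_alpha_apply \<alpha> G y v = \<alpha> * real (card (nbrs G v)) * y v + (1 - \<alpha>) * (\<Sum>w\<in>nbrs G v. y w)"

definition A_alpha_eigenpair :: "real \<Rightarrow> 'a pair_pre_digraph \<Rightarrow> real \<Rightarrow> ('a \<Rightarrow> real) \<Rightarrow> bool" where
  "A_alpha_eigenpair \<alpha> G x y \<longleftrightarrow>
     (\<exists>v\<in>pverts G. y v \<noteq> 0) \<and> (\<forall>v\<in>pverts G. A_alpha_apply \<alpha> G y v = x * y v)"

lemma (in pair_graph) eigenvalue_iff_eigenpair:
  assumes "distinct vs" "set vs = pverts G"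
  shows "eigenvalue (A_alpha \<alpha> G vs) x \<longleftrightarrow> (\<exists>y. A_alpha_eigenpair \<alpha> G x y)"
proof -
  have "(\<Sum>w\<in>pverts G. if (v, w) \<in> parcs G then y w else 0) = (\<Sum>w\<in>nbrs G v. y w)"
    for v and y :: "'a \<Rightarrow> real"
  proof -
    have "{w \<in> pverts G. (v, w) \<in> parcs G} = nbrs G v" by (auto dest: in_arcsD2)
    then show ?thesis by (simp flip: sum.inter_filter add: pair_finite_verts)
  qed
  then show ?thesis
    unfolding eigenvalue_A_alpha_iff[OF assms] A_alpha_eigenpair_def A_alpha_apply_def
    by (simp add: gdegree_eq_card_nbrs)
qed

text \<open>A matrix spectrum is finite, and this one is nonempty by symmetry, so the
  \<open>Max\<close> is attained. The rest of the argument uses the index only through these two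
  facts.\<close>

lemma (in pair_graph) alpha_index_eigenpair:
  assumes "pverts G \<noteq> {}"
  shows "\<exists>y. A_alpha_eigenpair \<alpha> G (alpha_index \<alpha> G) y"
    and "A_alpha_eigenpair \<alpha> G x y \<Longrightarrow> x \<le> alpha_index \<alpha> G"
proof -
  define vs where "vs = (SOME vs. distinct vs \<and> set vs = pverts G)"
  have "\<exists>vs. distinct vs \<and> set vs = pverts G"
    using finite_distinct_list[OF pair_finite_verts] by blast
  then have vs: "distinct vs" "set vs = pverts G"
    unfolding vs_def by (metis (mono_tags, lifting) someI_ex)+
  let ?A = "A_alpha \<alpha> G vs" and ?E = "{x. eigenvalue (A_alpha \<alpha> G vs) x}"
  have A: "?A \<in> carrier_mat (length vs) (length vs)"
    by (simp add: A_alpha_def adjacency_mat_def degree_mat_def)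
  have "?A\<^sup>T = ?A"
    using nbrs_sym by (intro eq_matI) (auto simp: A_alpha_def adjacency_mat_def degree_mat_def)
  moreover have "length vs > 0" using vs assms by auto
  ultimately have ne: "?E \<noteq> {}" using symmetric_real_mat_has_eigenvalue[OF A] by auto
  have fin: "finite ?E" using card_finite_spectrum(1)[OF A] by (simp add: spectrum_def)
  have idx: "alpha_index \<alpha> G = Max ?E" by (simp add: alpha_index_def vs_def)
  show "\<exists>y. A_alpha_eigenpair \<alpha> G (alpha_index \<alpha> G) y"
    using Max_in[OF fin ne] idx eigenvalue_iff_eigenpair[OF vs] by auto
  show "A_alpha_eigenpair \<alpha> G x y \<Longrightarrow> x \<le> alpha_index \<alpha> G"
    using Max_ge[OF fin] idx eigenvalue_iff_eigenpair[OF vs] by auto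
qed

text \<open>
  Compare an eigenvector \<open>z\<close> with the positive vector \<open>y\<close> at the vertices where \<open>\<bar>z\<bar> / y\<close> is
  maximal; this is the set \<open>U\<close> of the equality case.
\<close>

lemma (in pair_graph) eigenpair_le_supersolution:
  assumes \<alpha>: "0 \<le> \<alpha>" "\<alpha> < 1" and y: "\<And>v. v \<in> pverts G \<Longrightarrow> y v > 0"
    and super: "\<And>v. v \<in> pverts G \<Longrightarrow> A_alpha_apply \<alpha> G y v \<le> \<theta> * y v"
    and z: "A_alpha_eigenpair \<alpha> G x z"
  shows "x \<le> \<theta>"
    and "x = \<theta> \<Longrightarrow> \<exists>U\<subseteq>pverts G. U \<noteq> {} \<and>
      (\<forall>v\<in>U. A_alpha_apply \<alpha> G y v = \<theta> * y v \<and> nbrs G v \<subseteq> U)"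
proof -
  define V where "V = pverts G"
  define r where "r v = \<bar>z v\<bar> / y v" for v
  define t where "t = Max (r ` V)"
  have ne: "V \<noteq> {}" and fin: "finite V" using z pair_finite_verts by (auto simp: V_def A_alpha_eigenpair_def)
  have NV: "nbrs G v \<subseteq> V" for v unfolding V_def by (rule nbrs_subset) unfold_locales
  have finN: "finite (nbrs G v)" for v using NV fin finite_subset by blast
  have "r v \<le> t" if "v \<in> V" for v using that fin by (simp add: t_def)
  then have le: "\<bar>z v\<bar> \<le> t * y v" if "v \<in> V" for v
    using that y[of v] by (simp add: r_def V_def divide_le_eq)
  define U where "U = {v \<in> V. \<bar>z v\<bar> = t * y v}"
  have "t \<in> r ` V" unfolding t_def using ne fin by (intro Max_in) auto
  then have U: "U \<noteq> {}" using y by (force simp: U_def r_def V_def)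
  have t: "t > 0"
  proof -
    obtain v where v: "v \<in> V" "z v \<noteq> 0" using z by (auto simp: A_alpha_eigenpair_def V_def)
    then have "0 < t * y v" using le[of v] by linarith
    then show ?thesis using y[of v] v(1) by (simp add: V_def zero_less_mult_iff)
  qed
  \<comment> \<open>At a vertex of \<open>U\<close> the triangle inequality bounds
    \<open>x * t * y v\<close> by a sum over \<open>\<bar>z w\<bar>\<close>, and the supersolution
    property bounds the same sum over \<open>t * y w\<close> by \<open>\<theta> * t * y v\<close>.
    Since \<open>\<bar>z w\<bar> \<le> t * y w\<close>, the two chains join.\<close>
  have chain: "x * (t * y v) \<le> \<alpha> * card (nbrs G v) * (t * y v) + (1 - \<alpha>) * (\<Sum>w\<in>nbrs G v. \<bar>z w\<bar>)"
    and chain': "\<alpha> * card (nbrs G v) * (t * y v) + (1 - \<alpha>) * (\<Sum>w\<in>nbrs G v. t * y w) \<le> \<theta> * (t * y v)"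
    if v: "v \<in> U" for v
  proof -
    have "x * (t * y v) \<le> \<bar>x * z v\<bar>"
    proof -
      have "x * (t * y v) \<le> \<bar>x\<bar> * (t * y v)" using v t y by (intro mult_right_mono) (auto simp: U_def V_def)
      then show ?thesis using v by (simp add: U_def abs_mult)
    qed
    also have "\<dots> = \<bar>A_alpha_apply \<alpha> G z v\<bar>" using z v by (simp add: A_alpha_eigenpair_def U_def V_def)
    also have "\<dots> \<le> \<bar>\<alpha> * card (nbrs G v) * z v\<bar> + \<bar>(1 - \<alpha>) * (\<Sum>w\<in>nbrs G v. z w)\<bar>"
      unfolding A_alpha_apply_def by (rule abs_triangle_ineq)
    also have "\<dots> \<le> \<alpha> * card (nbrs G v) * (t * y v) + (1 - \<alpha>) * (\<Sum>w\<in>nbrs G v. \<bar>z w\<bar>)"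
      using \<alpha> v by (auto simp: abs_mult U_def intro!: mult_left_mono)
    finally show "x * (t * y v) \<le> \<alpha> * card (nbrs G v) * (t * y v) + (1 - \<alpha>) * (\<Sum>w\<in>nbrs G v. \<bar>z w\<bar>)" .
    have "t * A_alpha_apply \<alpha> G y v \<le> t * (\<theta> * y v)"
      using t v super[of v] by (intro mult_left_mono) (auto simp: U_def V_def)
    then show "\<alpha> * card (nbrs G v) * (t * y v) + (1 - \<alpha>) * (\<Sum>w\<in>nbrs G v. t * y w) \<le> \<theta> * (t * y v)"
      by (simp add: A_alpha_apply_def sum_distrib_left algebra_simps)
  qed
  have mid: "(\<Sum>w\<in>nbrs G v. \<bar>z w\<bar>) \<le> (\<Sum>w\<in>nbrs G v. t * y w)" for v
    using le NV by (intro sum_mono) blast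
  have mid': "(1 - \<alpha>) * (\<Sum>w\<in>nbrs G v. \<bar>z w\<bar>) \<le> (1 - \<alpha>) * (\<Sum>w\<in>nbrs G v. t * y w)" for v
    using \<alpha> mid by (intro mult_left_mono) auto
  have ty: "t * y v > 0" if "v \<in> U" for v using that t y by (simp add: U_def V_def)
  show "x \<le> \<theta>"
  proof -
    obtain v where v: "v \<in> U" using U by blast
    have "x * (t * y v) \<le> \<theta> * (t * y v)"
      using chain[OF v] chain'[OF v] mid'[of v] by linarith
    then show ?thesis using ty[OF v] by (simp only: mult_le_cancel_right_pos)
  qed
  assume x: "x = \<theta>"
  have "A_alpha_apply \<alpha> G y v = \<theta> * y v \<and> nbrs G v \<subseteq> U" if v: "v \<in> U" for v
  proof
    \<comment> \<open>When \<open>x = \<theta>\<close> every link of the chain is an equality. As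
      \<open>1 - \<alpha>\<close> is nonzero it cancels, and each neighbour \<open>w\<close>
      satisfies \<open>\<bar>z w\<bar> = t * y w\<close>, so it lies in \<open>U\<close> as
      well.\<close>
    have sums: "(1 - \<alpha>) * (\<Sum>w\<in>nbrs G v. \<bar>z w\<bar>) = (1 - \<alpha>) * (\<Sum>w\<in>nbrs G v. t * y w)"
      using chain[OF v, unfolded x] chain'[OF v] mid'[of v] by linarith
    have eq: "\<alpha> * card (nbrs G v) * (t * y v) + (1 - \<alpha>) * (\<Sum>w\<in>nbrs G v. t * y w) = \<theta> * (t * y v)"
      using chain[OF v, unfolded x] chain'[OF v] mid'[of v] by linarith
    have "(\<Sum>w\<in>nbrs G v. t * y w - \<bar>z w\<bar>) = 0"
      using \<alpha> sums by (simp add: sum_subtractf)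
    moreover have "0 \<le> t * y w - \<bar>z w\<bar>" if "w \<in> nbrs G v" for w using le[of w] NV that by auto
    ultimately have "\<forall>w\<in>nbrs G v. t * y w - \<bar>z w\<bar> = 0"
      using sum_nonneg_eq_0_iff[OF finN] by (metis (no_types, lifting))
    then show "nbrs G v \<subseteq> U" using NV by (auto simp: U_def)
    have "t * A_alpha_apply \<alpha> G y v = t * (\<theta> * y v)"
      using eq by (simp add: A_alpha_apply_def sum_distrib_left algebra_simps)
    then show "A_alpha_apply \<alpha> G y v = \<theta> * y v" using t by simp
  qed
  then show "\<exists>U\<subseteq>pverts G. U \<noteq> {} \<and>
      (\<forall>v\<in>U. A_alpha_apply \<alpha> G y v = \<theta> * y v \<and> nbrs G v \<subseteq> U)"
    using U by (intro exI[of _ U]) (auto simp: U_def V_def)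
qed

section \<open>Joins of a complete graph and a regular graph\<close>

text \<open>The internal form of being a join of the complete graph on \<open>L\<close> with an
  \<open>r\<close>-regular graph. The equality analysis produces this form, and the next lemmas
  translate it to and from an isomorphism.\<close>

definition regular_join :: "'a pair_pre_digraph \<Rightarrow> 'a set \<Rightarrow> nat \<Rightarrow> bool" where
  "regular_join G L r \<longleftrightarrow> L \<subseteq> pverts G \<and> (\<forall>v\<in>L. nbrs G v = pverts G - {v}) \<and>
     (\<forall>v\<in>pverts G - L. card (nbrs G v - L) = r)"

lemma pair_wf_complete_join:
  assumes "pair_wf_digraph H"
  shows "pair_wf_digraph (complete_graph m \<nabla> H)"
  using pair_wf_digraph.wellformed'[OF assms]
  by unfold_locales (auto simp: graph_join_def complete_graph_def)

lemma complete_join_arcs: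
  "(Inl i, Inl j) \<in> parcs (complete_graph m \<nabla> H) \<longleftrightarrow> i < m \<and> j < m \<and> i \<noteq> j"
  "(Inl i, Inr y) \<in> parcs (complete_graph m \<nabla> H) \<longleftrightarrow> i < m \<and> y \<in> pverts H"
  "(Inr y, Inl i) \<in> parcs (complete_graph m \<nabla> H) \<longleftrightarrow> i < m \<and> y \<in> pverts H"
  "(Inr x, Inr y) \<in> parcs (complete_graph m \<nabla> H) \<longleftrightarrow> (x, y) \<in> parcs H"
  using map_prod_image_iff[of Inr UNIV "parcs H" x y]
  by (auto simp: graph_join_def complete_graph_def)

lemma complete_join_verts: "pverts (complete_graph m \<nabla> H) = Inl ` {..<m} \<union> Inr ` pverts H"
  by (auto simp: graph_join_def complete_graph_def)

text \<open>\<open>L\<close> is the preimage of the complete part. The isomorphism carries the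
  neighbours of \<open>v\<close> outside \<open>L\<close> onto the neighbours in \<open>H\<close> of
  the vertex corresponding to \<open>v\<close>.\<close>

lemma (in pair_graph) regular_join_if_isomorphic:
  assumes H: "pair_graph H" "regular_graph r H"
    and iso: "graph_isomorphic G (complete_graph m \<nabla> H)"
  shows "\<exists>L. card L = m \<and> regular_join G L r"
proof -
  let ?J = "complete_graph m \<nabla> H"
  interpret H: pair_graph H by fact
  have wfG: "pair_wf_digraph G" and wfH: "pair_wf_digraph H" by unfold_locales
  obtain h where bij: "bij_betw h (pverts G) (pverts ?J)"
    and h: "\<And>u v. u \<in> pverts G \<Longrightarrow> v \<in> pverts G \<Longrightarrow> (u, v) \<in> parcs G \<longleftrightarrow> (h u, h v) \<in> parcs ?J"
    using iso unfolding graph_isomorphic_iff[OF wfG pair_wf_complete_join[OF wfH]] by blast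
  define L where "L = {v \<in> pverts G. h v \<in> Inl ` {..<m}}"
  have inj: "inj_on h (pverts G)" and im: "h ` pverts G = Inl ` {..<m} \<union> Inr ` pverts H"
    using bij by (auto simp: bij_betw_def complete_join_verts)
  have R: "h v \<in> Inr ` pverts H" if "v \<in> pverts G - L" for v
    using that im by (auto simp: L_def)
  have "h ` L = h ` pverts G \<inter> Inl ` {..<m}" by (auto simp: L_def)
  then have "h ` L = Inl ` {..<m}" using im by auto
  moreover have "inj_on h L" using inj by (auto simp: L_def inj_on_def)
  ultimately have "card L = card (Inl ` {..<m} :: (nat + 'b) set)" by (metis card_image)
  then have "card L = m" by (simp add: card_image)
  moreover have "regular_join G L r"
    unfolding regular_join_def
  proof (intro conjI ballI)
    show "L \<subseteq> pverts G" by (auto simp: L_def)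
    fix v assume v: "v \<in> L"
    then obtain i where i: "v \<in> pverts G" "h v = Inl i" "i < m" by (auto simp: L_def)
    have "(v, w) \<in> parcs G" if w: "w \<in> pverts G" "w \<noteq> v" for w
    proof -
      have "h w \<noteq> h v" using inj_onD[OF inj] i(1) w by metis
      moreover have "h w \<in> Inl ` {..<m} \<union> Inr ` pverts H" using im w by blast
      ultimately show ?thesis using h[OF i(1) w(1)] i by (auto simp: complete_join_arcs)
    qed
    then show "nbrs G v = pverts G - {v}"
      using self_notin_nbrs[of v] nbrs_subset[OF wfG, of v] by auto
  next
    fix v assume v: "v \<in> pverts G - L"
    obtain x where x: "x \<in> pverts H" "h v = Inr x" using R[OF v] by blast
    have "h ` (nbrs G v - L) = Inr ` nbrs H x"
    proof
      show "h ` (nbrs G v - L) \<subseteq> Inr ` nbrs H x"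
      proof
        fix z assume "z \<in> h ` (nbrs G v - L)"
        then obtain w where w: "(v, w) \<in> parcs G" "w \<in> pverts G - L" "z = h w"
          using nbrs_subset[OF wfG, of v] by auto
        then show "z \<in> Inr ` nbrs H x"
          using R[OF w(2)] h[of v w] v x by (auto simp: complete_join_arcs)
      qed
      show "Inr ` nbrs H x \<subseteq> h ` (nbrs G v - L)"
      proof
        fix z :: "nat + 'b" assume "z \<in> Inr ` nbrs H x"
        then obtain y where y: "(x, y) \<in> parcs H" "z = Inr y" by blast
        then obtain w where w: "w \<in> pverts G" "h w = Inr y"
          using im H.in_arcsD2 by (metis UnCI image_iff)
        then show "z \<in> h ` (nbrs G v - L)"
          using h[of v w] v x y by (force simp: complete_join_arcs L_def)
      qed
    qed
    moreover have "inj_on h (nbrs G v - L)"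
      using inj nbrs_subset[OF wfG, of v] by (meson Diff_subset inj_on_subset)
    ultimately have "card (nbrs G v - L) = card (Inr ` nbrs H x :: (nat + 'b) set)"
      by (metis card_image)
    also have "\<dots> = r"
      using H(2) x(1) by (simp add: card_image regular_graph_def gdegree_eq_card_nbrs)
    finally show "card (nbrs G v - L) = r" .
  qed
  ultimately show ?thesis by blast
qed

text \<open>\<open>H\<close> is the graph induced outside \<open>L\<close>, relabelled by
  \<open>g\<close> with an initial segment of the naturals; \<open>c\<close> numbers the vertices of
  \<open>L\<close> for the complete part.\<close>

lemma (in pair_graph) isomorphic_if_regular_join:
  assumes L: "regular_join G L r"
  shows "\<exists>H :: nat pair_pre_digraph. pair_graph H \<and> card (pverts H) = card (pverts G) - card L \<and>
    regular_graph r H \<and> graph_isomorphic G (complete_graph (card L) \<nabla> H)"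
proof -
  define R where "R = pverts G - L"
  have LV: "L \<subseteq> pverts G" using L by (simp add: regular_join_def)
  then have fin: "finite L" "finite R"
    using finite_subset[OF _ pair_finite_verts] by (simp_all add: R_def pair_finite_verts)
  have cR: "card R = card (pverts G) - card L" using LV fin by (simp add: R_def card_Diff_subset)
  obtain g where g: "bij_betw g R {..<card R}"
    using ex_bij_betw_finite_nat[OF fin(2)] by (auto simp: lessThan_atLeast0)
  obtain c where c: "bij_betw c L {..<card L}"
    using ex_bij_betw_finite_nat[OF fin(1)] by (auto simp: lessThan_atLeast0)
  have gi: "inj_on g R" "g ` R = {..<card R}" and ci: "inj_on c L" "c ` L = {..<card L}"
    using g c by (auto simp: bij_betw_def)
  define H where "H = \<lparr>pverts = {..<card R}, parcs = map_prod g g ` (parcs G \<inter> R \<times> R)\<rparr>"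
  have arcH: "(g u, g v) \<in> parcs H \<longleftrightarrow> (u, v) \<in> parcs G" if "u \<in> R" "v \<in> R" for u v
    using map_prod_image_iff[OF gi(1), of "parcs G \<inter> R \<times> R" u v] that by (auto simp: H_def)
  have H: "pair_graph H"
  proof
    show "e \<in> parcs H \<Longrightarrow> fst e \<in> pverts H" "e \<in> parcs H \<Longrightarrow> snd e \<in> pverts H" for e
      using gi(2) by (auto simp: H_def)
    show "finite (pverts H)" "finite (parcs H)" using pair_finite_arcs by (auto simp: H_def)
    show "fst e \<noteq> snd e" if "e \<in> parcs H" for e
      using that gi(1) pair_no_loops by (force simp: H_def dest: inj_onD)
    show "symmetric (with_proj H)"
      using nbrs_sym by (force simp: symmetric_def sym_def H_def)
  qed
  interpret H: pair_graph H by fact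
  have wfG: "pair_wf_digraph G" and wfH: "pair_wf_digraph H" by unfold_locales
  have "regular_graph r H"
    unfolding regular_graph_def gdegree_eq_card_nbrs
  proof
    fix x assume "x \<in> pverts H"
    then obtain u where u: "u \<in> R" "x = g u" using gi(2) by (auto simp: H_def)
    have sub: "nbrs G u - L \<subseteq> R" using nbrs_subset[OF wfG, of u] by (auto simp: R_def)
    have "nbrs H x = g ` (nbrs G u - L)"
    proof
      show "nbrs H x \<subseteq> g ` (nbrs G u - L)"
        using u gi(1) by (fastforce simp: H_def R_def dest: inj_onD)
      show "g ` (nbrs G u - L) \<subseteq> nbrs H x" using u sub arcH by auto
    qed
    then have "card (nbrs H x) = card (nbrs G u - L)"
      using sub gi(1) by (metis card_image inj_on_subset)
    then show "card (nbrs H x) = r" using L u(1) by (simp add: regular_join_def R_def)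
  qed
  moreover have "graph_isomorphic G (complete_graph (card L) \<nabla> H)"
    unfolding graph_isomorphic_iff[OF wfG pair_wf_complete_join[OF wfH]]
  proof (intro exI conjI ballI)
    define h where "h v = (if v \<in> L then Inl (c v) else Inr (g v))" for v
    have LR: "pverts G = L \<union> R" "L \<inter> R = {}" using LV by (auto simp: R_def)
    show "bij_betw h (pverts G) (pverts (complete_graph (card L) \<nabla> H))"
      unfolding bij_betw_def
    proof
      show "inj_on h (pverts G)"
        using gi(1) ci(1) by (auto simp: inj_on_def h_def R_def)
      have "h ` pverts G = h ` L \<union> h ` R" using LR by blast
      also have "h ` L = Inl ` c ` L" by (auto simp: h_def)
      also have "h ` R = Inr ` g ` R" using LR by (force simp: h_def)
      finally show "h ` pverts G = pverts (complete_graph (card L) \<nabla> H)"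
        using gi(2) ci(2) by (simp add: complete_join_verts H_def)
    qed
    fix u v assume uv: "u \<in> pverts G" "v \<in> pverts G"
    have cl: "c w < card L" if "w \<in> L" for w using ci(2) that by blast
    have gH: "g w \<in> pverts H" if "w \<notin> L" "w \<in> pverts G" for w using gi(2) that by (auto simp: H_def R_def)
    have dom: "(a, w) \<in> parcs G \<longleftrightarrow> a \<noteq> w" if "a \<in> L" "w \<in> pverts G" for a w
      using L that unfolding regular_join_def by blast
    show "(u, v) \<in> parcs G \<longleftrightarrow> (h u, h v) \<in> parcs (complete_graph (card L) \<nabla> H)"
    proof (cases "u \<in> L"; cases "v \<in> L")
      assume "u \<in> L" "v \<in> L"
      then show ?thesis using dom uv cl ci(1) by (auto simp: h_def complete_join_arcs dest: inj_onD)
    next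
      assume "u \<in> L" "v \<notin> L"
      then show ?thesis using dom uv cl gH by (auto simp: h_def complete_join_arcs)
    next
      assume "u \<notin> L" "v \<in> L"
      then show ?thesis using dom[of v u] nbrs_sym[of u v] uv cl gH by (auto simp: h_def complete_join_arcs)
    next
      assume "u \<notin> L" "v \<notin> L"
      then show ?thesis using arcH[of u v] uv by (simp add: h_def complete_join_arcs R_def)
    qed
  qed
  ultimately show ?thesis using H cR by (intro exI[of _ H]) (simp add: H_def)
qed

section \<open>The largest root\<close>

text \<open>The discriminant is \<open>(a - b)\<^sup>2 + 4 * c\<close>. Since \<open>c > 0\<close>,
  its square root exceeds \<open>\<bar>a - b\<bar>\<close>, which puts the larger root above both
  \<open>a\<close> and \<open>b\<close>.\<close>

lemma largest_root_quadratic: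
  fixes a b c :: real
  assumes c: "c > 0" and f: "\<And>x. f x = (x - a) * (x - b) - c"
  shows "largest_root f > a" "largest_root f > b"
    and "(largest_root f - a) * (largest_root f - b) = c"
proof -
  define s where "s = sqrt ((a - b)\<^sup>2 + 4 * c)"
  have s2: "s\<^sup>2 = (a - b)\<^sup>2 + 4 * c" using c by (simp add: s_def)
  define p where "p = (a + b + s) / 2"
  define q where "q = (a + b - s) / 2"
  have f': "f x = (x - p) * (x - q)" for x
    using s2 by (simp add: f p_def q_def field_simps power2_eq_square)
  have "{x. f x = 0} = {p, q}" by (auto simp: f')
  moreover have "\<bar>a - b\<bar> < s" using c by (auto simp: s_def intro: real_less_rsqrt)
  ultimately have lr: "largest_root f = p" and ab: "p > a" "p > b"
    by (auto simp: largest_root_def p_def q_def)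
  have "f p = 0" by (simp add: f')
  then show "largest_root f > a" "largest_root f > b"
    and "(largest_root f - a) * (largest_root f - b) = c"
    using ab by (simp_all add: lr f)
qed

text \<open>Exhibits \<open>f_alpha\<close> as the characteristic polynomial of the quotient matrix
  of the extremal join: the two subtracted constants are its diagonal entries, and the last term is
  the product of its off-diagonal entries.\<close>

lemma f_alpha_factored:
  "f_alpha \<alpha> n k \<delta> x =
    (x - (\<alpha> * (real n - (real k - 1)) + (real k - 1) - 1)) * (x - (\<alpha> * (real k - 1) + (real \<delta> - 1)))
      - (1 - \<alpha>)\<^sup>2 * (real k - 1) * (real n - (real k - 1))"
  by (simp add: f_alpha_def algebra_simps power2_eq_square)

section \<open>The two-valued test vector\<close>

definition two_valued :: "'a set \<Rightarrow> real \<Rightarrow> 'a \<Rightarrow> real" where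
  "two_valued L b v = (if v \<in> L then 1 else b)"

lemma (in pair_graph) A_alpha_apply_two_valued:
  "A_alpha_apply \<alpha> G (two_valued L b) v =
     \<alpha> * (real (card (nbrs G v \<inter> L)) + real (card (nbrs G v - L))) * two_valued L b v
       + (1 - \<alpha>) * (real (card (nbrs G v \<inter> L)) + real (card (nbrs G v - L)) * b)"
proof -
  have wf: "pair_wf_digraph G" ..
  have fin: "finite (nbrs G v)" using nbrs_subset[OF wf] pair_finite_verts finite_subset by blast
  have "(\<Sum>w\<in>nbrs G v. two_valued L b w) =
      (\<Sum>w\<in>nbrs G v \<inter> L. two_valued L b w) + (\<Sum>w\<in>nbrs G v - L. two_valued L b w)"
    by (rule sum.Int_Diff[OF fin])
  also have "(\<Sum>w\<in>nbrs G v \<inter> L. two_valued L b w) = card (nbrs G v \<inter> L)"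
    by (simp add: two_valued_def)
  also have "(\<Sum>w\<in>nbrs G v - L. two_valued L b w) = card (nbrs G v - L) * b"
    by (simp add: two_valued_def)
  finally show ?thesis
    using card_Int_Diff[OF fin, of L] by (simp add: A_alpha_apply_def)
qed

text \<open>
  The vector with value \<open>1\<close> on \<open>K\<close> vertices joined to all others and \<open>b\<close> on the remaining \<open>m\<close>
  vertices, which induce an \<open>r\<close>-regular graph, is an eigenvector for \<open>\<theta>\<close> exactly under
  the two equations below.
\<close>

locale join_eigenvector = pair_graph G
  for G :: "'a pair_pre_digraph" and L :: "'a set" and \<alpha> \<theta> b :: real and K m r :: nat +
  assumes \<alpha>: "0 < \<alpha>" "\<alpha> < 1" and K: "K \<ge> 1" and b: "b > 0"
    and L: "L \<subseteq> pverts G" and order: "card (pverts G) = K + m"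
    and \<theta>: "\<theta> = \<alpha> * m + K - 1 + (1 - \<alpha>) * m * b"
    and \<theta>b: "\<theta> * b = (\<alpha> * K + r) * b + (1 - \<alpha>) * K"
begin

lemma finite_L: "finite L"
  using L pair_finite_verts finite_subset by blast

lemma wf: "pair_wf_digraph G"
  by unfold_locales

lemma finite_nbrs: "finite (nbrs G v)"
  using nbrs_subset[OF wf] pair_finite_verts finite_subset by blast

lemma two_valued_pos: "two_valued L b v > 0"
  using b by (simp add: two_valued_def)

lemma nbrs_in_L_le: "v \<in> L \<Longrightarrow> card (nbrs G v \<inter> L) \<le> card L - 1"
  using card_mono[of "L - {v}" "nbrs G v \<inter> L"] self_notin_nbrs[of v] finite_L by auto

lemma nbrs_in_L_le': "card (nbrs G v \<inter> L) \<le> card L"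
  using finite_L by (intro card_mono) auto

lemma nbrs_outside_L_le: "card (nbrs G v - L) \<le> card (pverts G) - card L"
  using card_mono[of "pverts G - L" "nbrs G v - L"] nbrs_subset[OF wf, of v] pair_finite_verts L finite_L
  by (auto simp: card_Diff_subset)

text \<open>The equations for \<open>\<theta>\<close> and \<open>b\<close> are the eigenvalue
  equations at a vertex inside and outside \<open>L\<close>. This supplies the lower bound
  \<open>\<theta>\<close> for the index of an extremal graph.\<close>

lemma eigenpair_if_regular_join:
  assumes "regular_join G L r" "card L = K"
  shows "A_alpha_eigenpair \<alpha> G \<theta> (two_valued L b)"
  unfolding A_alpha_eigenpair_def
proof
  have "pverts G \<noteq> {}" using order K by auto
  then show "\<exists>v\<in>pverts G. two_valued L b v \<noteq> 0" using two_valued_pos by (metis all_not_in_conv less_irrefl)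
  show "\<forall>v\<in>pverts G. A_alpha_apply \<alpha> G (two_valued L b) v = \<theta> * two_valued L b v"
  proof
    fix v assume v: "v \<in> pverts G"
    show "A_alpha_apply \<alpha> G (two_valued L b) v = \<theta> * two_valued L b v"
    proof (cases "v \<in> L")
      case True
      then have N: "nbrs G v = pverts G - {v}" using assms by (simp add: regular_join_def)
      have "nbrs G v \<inter> L = L - {v}" "nbrs G v - L = pverts G - L" using N L True by auto
      then have "card (nbrs G v \<inter> L) = K - 1" "card (nbrs G v - L) = m"
        using True assms(2) finite_L L order by (simp_all add: card_Diff_subset)
      then show ?thesis
        using True K by (simp add: A_alpha_apply_two_valued two_valued_def \<theta> of_nat_diff algebra_simps)
    next
      case False
      have "L \<subseteq> nbrs G v"
      proof
        fix u assume "u \<in> L"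
        then have "v \<in> nbrs G u" using assms(1) False v by (auto simp: regular_join_def)
        then show "u \<in> nbrs G v" using nbrs_sym by blast
      qed
      then have "card (nbrs G v \<inter> L) = K" "card (nbrs G v - L) = r"
        using assms False v by (auto simp: regular_join_def Int_absorb1)
      then show ?thesis
        using False by (simp add: A_alpha_apply_two_valued two_valued_def \<theta>b algebra_simps)
    qed
  qed
qed

text \<open>The defect \<open>\<theta> * y v - A_alpha_apply \<alpha> G y v\<close> is a positive
  combination of the numbers of neighbours that \<open>v\<close> lacks, inside and outside
  \<open>L\<close>, compared with the extremal join. It is therefore nonnegative, and zero only if
  \<open>v\<close> lacks none.\<close>

lemma eigenvalue_le_if_sparse_outside:
  assumes cL: "card L = K" and out: "\<And>v. v \<in> pverts G - L \<Longrightarrow> card (nbrs G v - L) \<le> r"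
    and z: "A_alpha_eigenpair \<alpha> G x z"
  shows "x \<le> \<theta>" and "x = \<theta> \<Longrightarrow> regular_join G L r"
proof -
  let ?y = "two_valued L b"
  define p where "p v = card (nbrs G v \<inter> L)" for v
  define q where "q v = card (nbrs G v - L)" for v
  have inL: "\<theta> * ?y v - A_alpha_apply \<alpha> G ?y v =
      (real (K - 1) - p v) + (\<alpha> + (1 - \<alpha>) * b) * (real m - q v)" if "v \<in> L" for v
    using that K by (simp add: A_alpha_apply_two_valued two_valued_def \<theta> p_def q_def of_nat_diff algebra_simps)
  have outL: "\<theta> * ?y v - A_alpha_apply \<alpha> G ?y v =
      (\<alpha> * b + (1 - \<alpha>)) * (real K - p v) + b * (real r - q v)" if "v \<notin> L" for v
    using that by (simp add: A_alpha_apply_two_valued two_valued_def \<theta>b p_def q_def algebra_simps)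
  have coeffs: "\<alpha> + (1 - \<alpha>) * b > 0" "\<alpha> * b + (1 - \<alpha>) > 0" using \<alpha> b by (simp_all add: add_pos_pos)
  have pL: "p v \<le> K - 1" if "v \<in> L" for v using nbrs_in_L_le[OF that] cL by (simp add: p_def)
  have pK: "p v \<le> K" for v using nbrs_in_L_le'[of v] cL by (simp add: p_def)
  have qm: "q v \<le> m" for v using nbrs_outside_L_le[of v] cL order by (simp add: q_def)
  have qr: "q v \<le> r" if "v \<in> pverts G - L" for v using out[OF that] by (simp add: q_def)
  have "0 \<le> \<theta> * ?y v - A_alpha_apply \<alpha> G ?y v" if v: "v \<in> pverts G" for v
  proof (cases "v \<in> L")
    case True
    then show ?thesis using pL qm[of v] coeffs(1) by (simp add: inL del: of_nat_diff)
  next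
    case False
    then show ?thesis using pK[of v] qr[of v] v coeffs(2) b by (simp add: outL)
  qed
  then have super: "A_alpha_apply \<alpha> G ?y v \<le> \<theta> * ?y v" if "v \<in> pverts G" for v
    using that by force
  note \<alpha>' = less_imp_le[OF \<alpha>(1)] \<alpha>(2)
  show "x \<le> \<theta>" using eigenpair_le_supersolution(1)[OF \<alpha>' two_valued_pos super z] .
  assume "x = \<theta>"
  then obtain U where U: "U \<subseteq> pverts G" "U \<noteq> {}"
    and tight: "\<And>v. v \<in> U \<Longrightarrow> A_alpha_apply \<alpha> G ?y v = \<theta> * ?y v"
    and closed: "\<And>v. v \<in> U \<Longrightarrow> nbrs G v \<subseteq> U"
    using eigenpair_le_supersolution(2)[OF \<alpha>' two_valued_pos super z] by metis
  have tightL: "nbrs G v = pverts G - {v}" if v: "v \<in> U" "v \<in> L" for v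
  proof -
    have "(real (K - 1) - p v) + (\<alpha> + (1 - \<alpha>) * b) * (real m - q v) = 0"
      using tight[OF v(1)] inL[OF v(2)] by simp
    moreover have "0 \<le> real (K - 1) - p v" "0 \<le> (\<alpha> + (1 - \<alpha>) * b) * (real m - q v)"
      using pL[OF v(2)] qm[of v] coeffs(1) by (simp_all del: of_nat_diff)
    ultimately have "real (K - 1) - p v = 0" "(\<alpha> + (1 - \<alpha>) * b) * (real m - q v) = 0" by linarith+
    then have "p v = K - 1" "q v = m" using coeffs(1) by (simp_all del: of_nat_diff)
    then have "card (nbrs G v) = card (pverts G - {v})"
      using card_Int_Diff[OF finite_nbrs[of v], of L] v(2) L order K by (auto simp: p_def q_def)
    then show ?thesis
      using nbrs_subset[OF wf, of v] self_notin_nbrs[of v] pair_finite_verts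
      by (intro card_subset_eq) auto
  qed
  have tightR: "L \<subseteq> nbrs G v" "card (nbrs G v - L) = r" if v: "v \<in> U" "v \<notin> L" for v
  proof -
    have vG: "v \<in> pverts G - L" using v U by blast
    have "(\<alpha> * b + (1 - \<alpha>)) * (real K - p v) + b * (real r - q v) = 0"
      using tight[OF v(1)] outL[OF v(2)] by simp
    moreover have "0 \<le> (\<alpha> * b + (1 - \<alpha>)) * (real K - p v)" "0 \<le> b * (real r - q v)"
      using pK[of v] qr[OF vG] coeffs(2) b by simp_all
    ultimately have "(\<alpha> * b + (1 - \<alpha>)) * (real K - p v) = 0" "b * (real r - q v) = 0" by linarith+
    then have pq: "p v = K" "q v = r" using coeffs(2) b by simp_all
    then show "card (nbrs G v - L) = r" by (simp add: q_def)
    have "nbrs G v \<inter> L = L" using pq(1) cL finite_L by (intro card_subset_eq) (auto simp: p_def)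
    then show "L \<subseteq> nbrs G v" by blast
  qed
  \<comment> \<open>A tight vertex outside \<open>L\<close> is adjacent to all of the nonempty set
    \<open>L\<close>, so the closed set \<open>U\<close> meets \<open>L\<close>; a tight vertex of
    \<open>L\<close> is adjacent to every other vertex, so \<open>U\<close> is everything. This
    replaces connectivity of \<open>G\<close>.\<close>
  have "L \<noteq> {}" using cL K by auto
  obtain u where u: "u \<in> U" using U by blast
  then have "U \<inter> L \<noteq> {}" using tightR(1)[of u] closed[OF u] \<open>L \<noteq> {}\<close> by blast
  then obtain w where w: "w \<in> U" "w \<in> L" by blast
  have "U = pverts G" using tightL[OF w] closed[OF w(1)] w(1) U(1) by blast
  then show "regular_join G L r"
    using L tightL tightR by (auto simp: regular_join_def)
qed

text \<open>The test vector is now strict at every vertex. A vertex of \<open>L\<close> has at most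
  \<open>K - 2\<close> neighbours in \<open>L\<close>, a loss of one, while the possible excess of
  neighbours outside \<open>L\<close> gains at most \<open>K * b < 1\<close>. A vertex outside
  \<open>L\<close> has at most \<open>K - 1\<close> neighbours in \<open>L\<close>, a loss of
  \<open>1 - \<alpha>\<close>, while all terms carrying the factor \<open>b\<close> add up to at
  most \<open>D * b\<close>.\<close>

lemma eigenvalue_less_if_few_large_degrees:
  assumes cL: "card L < K" and deg: "\<And>v. v \<in> pverts G - L \<Longrightarrow> card (nbrs G v) \<le> D"
    and D: "K \<le> D" "D * b < 1 - \<alpha>" and z: "A_alpha_eigenpair \<alpha> G x z"
  shows "x < \<theta>"
proof -
  let ?y = "two_valued L b"
  have Kb: "K * b < 1"
  proof -
    have "K * b \<le> D * b" using D(1) b by simp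
    then show ?thesis using D(2) \<alpha> by linarith
  qed
  have "A_alpha_apply \<alpha> G ?y v < \<theta> * ?y v" if v: "v \<in> pverts G" for v
  proof -
    define p where "p = real (card (nbrs G v \<inter> L))"
    define q where "q = real (card (nbrs G v - L))"
    have pq: "p + q = card (nbrs G v)" "p \<ge> 0" "q \<ge> 0"
      using card_Int_Diff[OF finite_nbrs[of v], of L] by (simp_all add: p_def q_def)
    have y: "A_alpha_apply \<alpha> G ?y v = \<alpha> * (p + q) * ?y v + (1 - \<alpha>) * (p + q * b)"
      by (simp add: A_alpha_apply_two_valued p_def q_def)
    show ?thesis
    proof (cases "v \<in> L")
      case True
      have "card (nbrs G v) \<le> card (pverts G - {v})"
        using nbrs_subset[OF wf, of v] self_notin_nbrs[of v] pair_finite_verts by (intro card_mono) auto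
      then have pq1: "p + q \<le> real K + real m - 1" using pq(1) order v K by simp
      have pL: "p + 2 \<le> K" using nbrs_in_L_le[OF True] cL True finite_L card_gt_0_iff[of L]
        by (auto simp: p_def)
      have "q * b \<le> (real K + real m) * b" using pq1 pq b by (intro mult_right_mono) auto
      then have "p + q * b < real K - 1 + m * b" using pL Kb by (simp add: algebra_simps)
      then have "(1 - \<alpha>) * (p + q * b) < (1 - \<alpha>) * (real K - 1 + m * b)"
        using \<alpha> by (intro mult_strict_left_mono) auto
      moreover have "\<alpha> * (p + q) \<le> \<alpha> * (real K + real m - 1)" using pq1 \<alpha> by (intro mult_left_mono) auto
      moreover have "\<theta> = \<alpha> * (real K + real m - 1) + (1 - \<alpha>) * (real K - 1 + m * b)" by (simp add: \<theta> algebra_simps)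
      ultimately show ?thesis using True by (simp add: y two_valued_def)
    next
      case False
      have "p + q \<le> D" using deg[of v] v False pq(1) by simp
      then have "(p + q) * b \<le> D * b" using b by (intro mult_right_mono) auto
      moreover have "p + 1 \<le> K" using nbrs_in_L_le'[of v] cL by (simp add: p_def)
      then have "(1 - \<alpha>) * (p + 1) \<le> (1 - \<alpha>) * K" using \<alpha> by (intro mult_left_mono) auto
      moreover have "0 \<le> (1 - \<alpha>) * p * b" "0 \<le> (\<alpha> * K + r) * b" using \<alpha> b pq by simp_all
      moreover have "\<alpha> * (p + q) * b + (1 - \<alpha>) * (p + q * b) =
          (p + q) * b + (1 - \<alpha>) * (p + 1) - (1 - \<alpha>) - (1 - \<alpha>) * p * b" by (simp add: algebra_simps)
      ultimately show ?thesis using D(2) False by (simp add: y two_valued_def \<theta>b)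
    qed
  qed
  note strict = this
  note \<alpha>' = less_imp_le[OF \<alpha>(1)] \<alpha>(2)
  have super: "A_alpha_apply \<alpha> G ?y v \<le> \<theta> * ?y v" if "v \<in> pverts G" for v
    using strict[OF that] by simp
  have "x \<noteq> \<theta>"
  proof
    assume "x = \<theta>"
    then obtain U where "U \<subseteq> pverts G" "U \<noteq> {}" "\<And>v. v \<in> U \<Longrightarrow> A_alpha_apply \<alpha> G ?y v = \<theta> * ?y v"
      using eigenpair_le_supersolution(2)[OF \<alpha>' two_valued_pos super z] by metis
    then show False using strict by fastforce
  qed
  then show ?thesis using eigenpair_le_supersolution(1)[OF \<alpha>' two_valued_pos super z] by simp
qed

end

section \<open>The bound\<close>

theorem theorem1p3:
  fixes k n :: nat and d :: "nat \<Rightarrow> nat" and \<alpha> :: real and G :: "'a pair_pre_digraph"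
  assumes "k \<ge> 2"
    and "\<And>i j. 1 \<le> i \<Longrightarrow> i \<le> j \<Longrightarrow> j \<le> k \<Longrightarrow> d j \<le> d i"
    and "d k \<ge> 1"
    and "0 < \<alpha>" and "\<alpha> < 1"
    and "pair_graph G" and "card (pverts G) = n"
    and "graph_free (star_forest k d) G"
    and "real n \<ge> 4 * (real (\<Sum>i=1..k. d i) + real k - 2) * (real (\<Sum>i=1..k. d i) + 3 * real k - 5)
                 / \<alpha> ^ 3"
  shows "alpha_index \<alpha> G \<le> largest_root (f_alpha \<alpha> n k (d k)) \<and>
    (alpha_index \<alpha> G = largest_root (f_alpha \<alpha> n k (d k)) \<longleftrightarrow>
      (\<exists>H :: nat pair_pre_digraph. pair_graph H \<and> card (pverts H) = n - k + 1 \<and>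
         regular_graph (d k - 1) H \<and> graph_isomorphic G (complete_graph (k - 1) \<nabla> H)))"
proof -
  note k = assms(1) and \<alpha> = assms(4,5) and free = assms(8)
  interpret pair_graph G by fact

  \<comment> \<open>Numerical consequences of the bound on the order\<close>
  define s where "s = (\<Sum>i=1..k. d i)"
  \<comment> \<open>The extremal graph has \<open>K\<close> dominating vertices and an
    \<open>r\<close>-regular remainder on \<open>m\<close> vertices; \<open>D\<close> is the largest
    degree below the threshold \<open>s + k - 1\<close>.\<close>
  define K where "K = k - 1"
  define r where "r = d k - 1"
  define D where "D = s + k - 2"
  define m where "m = n - K"
  have kK: "k = K + 1" "K \<ge> 1" and dk: "d k = r + 1" using k assms(3) by (auto simp: K_def r_def)
  \<comment> \<open>The ordering of the \<open>d i\<close> enters only here, through the minimality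
    of \<open>d k\<close>.\<close>
  have "(\<Sum>i=1..k. r + 1) \<le> s"
    unfolding s_def dk[symmetric] using assms(2) by (intro sum_mono) auto
  then have "k * (r + 1) \<le> s" by simp
  moreover have "k * (r + 1) = K + 1 + r + K * r" by (simp add: kK algebra_simps)
  ultimately have s: "K + 1 + r \<le> s" by linarith
  have D: "real D = real s + K - 1" "2 * K + r \<le> D" using s kK by (auto simp: D_def of_nat_diff)
  \<comment> \<open>\<open>P\<close> dominates \<open>D * K\<close>, which makes \<open>b\<close>
    small enough, and leaves \<open>2 * K + r\<close> to absorb lower-order terms; it is still small
    enough for \<open>4 * P \<le> \<alpha> * n\<close>.\<close>
  define P where "P = real D * (real K + real r + 1)"
  have "D * (K + r + 1) \<ge> D * K + 2 * K + r"
    using D(2) mult_le_mono2[of 1 "r + 1" D] by (simp add: algebra_simps)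
  then have "real (D * K + 2 * K + r) \<le> real (D * (K + r + 1))" by (rule of_nat_mono)
  then have P: "real D * K + 2 * real K + real r \<le> P"
    unfolding P_def of_nat_add of_nat_mult by simp
  have "P \<ge> 0" by (simp add: P_def)
  have \<alpha>n: "\<alpha> * n \<ge> 4 * P"
  proof -
    have X: "P \<le> real D * (real s + 3 * real k - 5)"
      unfolding P_def using s kK by (intro mult_left_mono) simp_all
    have "\<alpha>\<^sup>2 \<le> 1" using \<alpha> by (simp add: power_le_one)
    then have "4 * P * \<alpha>\<^sup>2 \<le> 4 * P * 1" using \<open>P \<ge> 0\<close> by (intro mult_left_mono) simp_all
    also have "\<dots> \<le> 4 * (real D * (real s + 3 * real k - 5))" using X by simp
    also have "\<dots> = 4 * (real s + real k - 2) * (real s + 3 * real k - 5)" using D(1) kK by simp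
    also have "\<dots> \<le> n * \<alpha> ^ 3"
      using assms(9) \<alpha> by (simp add: s_def pos_divide_le_eq)
    also have "\<dots> = \<alpha> * n * \<alpha>\<^sup>2" by (simp add: power2_eq_square power3_eq_cube)
    finally show ?thesis using \<alpha> by simp
  qed
  have \<alpha>_le: "\<alpha> * x \<le> x" if "x \<ge> 0" for x
    using mult_right_mono[of \<alpha> 1 x] \<alpha> that by simp
  have DK: "real D * K \<ge> 0" by simp
  have "\<alpha> * n \<le> n" by (rule \<alpha>_le) simp
  moreover have "real K \<ge> 1" using kK by simp
  \<comment> \<open>This makes the natural subtractions \<open>n - K\<close> and
    \<open>n - k + 1\<close> exact and equal.\<close>
  ultimately have "real (K + 1) \<le> n"
    using \<alpha>n P DK \<open>P \<ge> 0\<close> unfolding of_nat_add of_nat_1 by linarith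
  then have nK: "n = K + m" "m \<ge> 1" by (auto simp: m_def)

  \<comment> \<open>The largest root and its eigenvector\<close>
  define \<theta> where "\<theta> = largest_root (f_alpha \<alpha> n k (d k))"
  have pos: "(1 - \<alpha>)\<^sup>2 * (real k - 1) * (real n - (real k - 1)) > 0"
    using \<alpha> kK nK by simp
  have \<theta>: "\<theta> > \<alpha> * m + K - 1" "\<theta> > \<alpha> * K + r"
    "(\<theta> - (\<alpha> * m + K - 1)) * (\<theta> - (\<alpha> * K + r)) = (1 - \<alpha>)\<^sup>2 * K * m"
    using largest_root_quadratic[OF pos f_alpha_factored, of "d k"] kK nK dk by (simp_all add: \<theta>_def)
  \<comment> \<open>This value is forced by the eigenvalue equation outside \<open>L\<close>; the
    equation on \<open>L\<close> then says that \<open>\<theta>\<close> is a root.\<close>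
  define b where "b = (1 - \<alpha>) * K / (\<theta> - (\<alpha> * K + r))"
  have b: "b > 0" using \<theta>(2) \<alpha> kK by (simp add: b_def)
  have \<theta>b: "\<theta> * b = (\<alpha> * K + r) * b + (1 - \<alpha>) * K"
    using \<theta>(2) by (simp add: b_def field_simps)
  have \<theta>': "\<theta> = \<alpha> * m + K - 1 + (1 - \<alpha>) * m * b"
  proof -
    have "(1 - \<alpha>) * m * b = (1 - \<alpha>)\<^sup>2 * K * m / (\<theta> - (\<alpha> * K + r))"
      by (simp add: b_def power2_eq_square)
    also have "\<dots> = \<theta> - (\<alpha> * m + K - 1)" using \<theta>(2) by (simp flip: \<theta>(3))
    finally show ?thesis by simp
  qed
  \<comment> \<open>The set is left arbitrary because it is instantiated both with the vertices of
    large degree and with the clique of a given join.\<close>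
  have join: "join_eigenvector G L \<alpha> \<theta> b K m r" if "L \<subseteq> pverts G" for L
    using that \<alpha> kK b \<theta>' \<theta>b nK assms(7) by unfold_locales auto
  have ne: "pverts G \<noteq> {}" using nK assms(7) by auto
  obtain z where z: "A_alpha_eigenpair \<alpha> G (alpha_index \<alpha> G) z"
    using alpha_index_eigenpair(1)[OF ne] by blast

  \<comment> \<open>Vertices of large degree\<close>
  define L where "L = {v \<in> pverts G. s + k - 1 \<le> card (nbrs G v)}"
  have LV: "L \<subseteq> pverts G" by (auto simp: L_def)
  have finL: "finite L" using LV pair_finite_verts finite_subset by blast
  \<comment> \<open>Stated for every \<open>K\<close>-element subset of \<open>L\<close>, since it
    also serves to show that \<open>L\<close> itself has at most \<open>K\<close> elements.\<close>
  have sparse: "card (nbrs G v - L') \<le> r" if "L' \<subseteq> L" "card L' = K" "v \<in> pverts G - L'" for L' v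
  proof (rule ccontr)
    assume "\<not> ?thesis"
    then have "d k \<le> card (nbrs G v - L')" using dk by simp
    then have "contains_graph G (star_forest k d)"
      using that assms(6) k
      by (intro contains_star_forest_of_large_degrees[of G k L']) (auto simp: L_def s_def K_def)
    then show False using free by simp
  qed
  have cL: "card L \<le> K"
  proof (rule ccontr)
    assume "\<not> card L \<le> K"
    then obtain L' where L': "L' \<subseteq> L" "card L' = K" by (meson nat_le_linear obtain_subset_with_card_n)
    then obtain v where v: "v \<in> L - L'" using \<open>\<not> card L \<le> K\<close> finL
      by (metis Diff_eq_empty_iff card_mono finite_subset all_not_in_conv)
    \<comment> \<open>The vertex \<open>v\<close> keeps at least \<open>s + k - 1 - K = s\<close>
      neighbours outside \<open>L'\<close>, and \<open>s > r\<close>.\<close>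
    have "card (nbrs G v) - card L' \<le> card (nbrs G v - L')"
      using finite_subset[OF L'(1) finL] by (rule diff_card_le_card_Diff)
    moreover have "card (nbrs G v - L') \<le> r" using sparse[OF L'] v by (auto simp: L_def)
    ultimately show False using v s kK L'(2) by (auto simp: L_def)
  qed

  \<comment> \<open>Comparison of the index with the largest root\<close>
  have bound: "alpha_index \<alpha> G \<le> \<theta> \<and> (alpha_index \<alpha> G = \<theta> \<longrightarrow> card L = K \<and> regular_join G L r)"
  proof (cases "card L = K")
    case True
    then show ?thesis
      using join_eigenvector.eigenvalue_le_if_sparse_outside[OF join[OF LV] True _ z] sparse by blast
  next
    case False
    \<comment> \<open>By the definition of \<open>b\<close> this is equivalent to
      \<open>D * b < 1 - \<alpha>\<close>. It holds because \<open>\<theta>\<close> exceeds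
      \<open>\<alpha> * m + K - 1\<close>, which is at least \<open>4 * P - 1\<close>.\<close>
    have "\<theta> - (\<alpha> * K + r) > real D * K"
    proof -
      have "\<alpha> * m = \<alpha> * n - \<alpha> * K" using nK by (simp add: algebra_simps)
      moreover have "\<alpha> * K \<le> K" by (rule \<alpha>_le) simp
      moreover have "real K \<ge> 1" using kK by simp
      ultimately show ?thesis using \<theta>(1) \<alpha>n P \<open>P \<ge> 0\<close> by linarith
    qed
    then have "(1 - \<alpha>) * (real D * K) < (1 - \<alpha>) * (\<theta> - (\<alpha> * K + r))"
      using \<alpha> by (intro mult_strict_left_mono) auto
    then have "D * b < 1 - \<alpha>" using \<theta>(2) by (simp add: b_def pos_divide_less_eq mult_ac)
    moreover have "card (nbrs G v) \<le> D" if "v \<in> pverts G - L" for v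
      using that k by (auto simp: L_def D_def)
    moreover have "card L < K" "K \<le> D" using False cL D(2) by simp_all
    ultimately have "alpha_index \<alpha> G < \<theta>"
      using join_eigenvector.eigenvalue_less_if_few_large_degrees[OF join[OF LV] _ _ _ _ z] by blast
    then show ?thesis by simp
  qed

  \<comment> \<open>The case of equality\<close>
  have "alpha_index \<alpha> G = \<theta> \<longleftrightarrow> (\<exists>L. card L = K \<and> regular_join G L r)"
  proof
    assume "\<exists>L. card L = K \<and> regular_join G L r"
    then obtain L where L: "card L = K" "regular_join G L r" by blast
    have "A_alpha_eigenpair \<alpha> G \<theta> (two_valued L b)"
      using L join_eigenvector.eigenpair_if_regular_join[OF join] by (simp add: regular_join_def)
    then show "alpha_index \<alpha> G = \<theta>" using alpha_index_eigenpair(2)[OF ne] bound by fastforce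
  qed (use bound in blast)
  also have "\<dots> \<longleftrightarrow> (\<exists>H :: nat pair_pre_digraph. pair_graph H \<and> card (pverts H) = n - k + 1 \<and>
         regular_graph (d k - 1) H \<and> graph_isomorphic G (complete_graph (k - 1) \<nabla> H))"
  proof -
    have "n - k + 1 = n - K" "r = d k - 1" "k - 1 = K" using nK kK by (auto simp: r_def)
    then show ?thesis
      using isomorphic_if_regular_join[of _ r] regular_join_if_isomorphic[of _ r K] assms(7) by metis
  qed
  finally show ?thesis using bound by (simp add: \<theta>_def)
qed

end
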